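(* Let $\mathcal U$ be a quantitative weak $\lambda$-theory over $\Sigma^{\mathbf{CL}}$. Then for every finite set $\Gamma$ of quantitative equations and every quantitative equation $\phi$ over $\mathbb T_{\Sigma^{\mathbf{CL}}}(\mathrm{Var})$, we have $(\Gamma\vdash\phi)\in\mathcal U$ if and only if $\Gamma\vDash_{\mathcal A}\phi$ holds for every quantitative $\Sigma^{\mathbf{CL}}$-algebra $\mathcal A$ satisfying $\mathcal U$.
   Context: Let $T$ be a set of types with a binary function $\to:T\times T\to T$. $\Sigma^{\mathbf{CL}}$ is the $T$-sorted signature consisting of binary application symbols $\cdot_{i,j}$ (arguments of sorts $i\to j$ and $i$, result of sort $j$; written infix, left-associative) and constants $\mathsf I_i:i\to i$, $\mathsf K_{ij}:i\to j\to i$, $\mathsf S_{ijk}:(i\to j\to k)\to(i\to j)\to(i\to k)$ for all $i,j,k\in T$. $\mathrm{Var}$ is a $T$-sorted set of variables, countably infinitely many of each sort, and $\mathbb T_{\Sigma^{\mathbf{CL}}}(\mathrm{Var})$ is the $T$-sorted set of terms built from variables and symbols; for a sort-preserving $f:\mathrm{Var}\to\mathbb T_{\Sigma^{\mathbf{CL}}}(\mathrm{Var})$ (or into an algebra), $f^\sharp$ is its unique homomorphic extension to terms (substitution/evaluation). A quantitative equation is $t\simeq^i_\epsilon s$ with $t,s$ terms of sort $i$ and $\epsilon\in\mathbb Q_{\ge0}$. A consequence relation is a relation $\vdash$ between sets of quantitative equations and quantitative equations closed under: (Cut) if $\Gamma\vdash\phi$ for all $\phi\in\Gamma'$ and $\Gamma'\vdash\psi$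 then $\Gamma\vdash\psi$; (Assumpt) $\phi\in\Gamma$ implies $\Gamma\vdash\phi$; (Refl) $\emptyset\vdash t\simeq_0 t$; (Symm) $\{t\simeq_\epsilon s\}\vdash s\simeq_\epsilon t$; (Triang) $\{t\simeq_\epsilon s,s\simeq_\delta u\}\vdash t\simeq_{\epsilon+\delta}u$; (Max) $\{t\simeq_\epsilon s\}\vdash t\simeq_{\epsilon+\delta}s$; (Arch) $\{t\simeq_\delta s\mid \delta>\epsilon\}\vdash t\simeq_\epsilon s$; (NExp) $\{t_1\simeq_\epsilon s_1,\dots,t_k\simeq_\epsilon s_k\}\vdash\sigma(t_1,\dots,t_k)\simeq_\epsilon\sigma(s_1,\dots,s_k)$ for each $k$-ary symbol $\sigma$; (Subst) if $\Gamma\vdash t\simeq_\epsilon s$ then $f^\sharp\Gamma\vdash f^\sharp t\simeq_\epsilon f^\sharp s$ for every substitution $f$ (all $\epsilon,\delta\in\mathbb Q_{\ge0}$, sorts matching). A basic quantitative inference is a pair (finite set of equations between variables $x\simeq_\epsilon y$, equation between terms). For a set $S$ of basic quantitative inferences, $\vdash_S$ is the least consequence relation containing $S$, and the theory generated by $S$ is $\mathcal U_S$, the set of pairs $(\Gamma,\phi)$ with $\Gamma$ finite and $\Gamma\vdash_S\phi$. A quantitative weak $\lambda$-theory is such a theory containing $\mathcal U_{\mathbf{CL}}$, the theory generated by $\emptyset\vdash\mathsf I_it\simeq_0 t$, $\emptyset\vdash\mathsf K_{ij}tu\simeq_0 t$, $\emptyset\vdash\mathsf S_{ijk}tuw\simeq_0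 tw(uw)$ for all terms of appropriate sorts. A quantitative $\Sigma^{\mathbf{CL}}$-algebra $\mathcal A$ is given by sets $A_i$ with pseudo-metrics $d_i:A_i\times A_i\to[0,\infty]$ and interpretations of the symbols as maps non-expansive w.r.t. the max-distance on products. $\Gamma\vDash_{\mathcal A}(t\simeq^i_\epsilon s)$ means: for every sort-preserving $f:\mathrm{Var}\to A$, if $d_{i'}(f^\sharp t',f^\sharp s')\le\epsilon'$ for all $(t'\simeq^{i'}_{\epsilon'}s')\in\Gamma$ then $d_i(f^\sharp t,f^\sharp s)\le\epsilon$. $\mathcal A$ satisfies $\mathcal U$ if $\Gamma\vDash_{\mathcal A}\phi$ for all $(\Gamma,\phi)\in\mathcal U$. *)

theory Defs
  imports Complex_Main "HOL-Library.Extended_Nonnegative_Real"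
begin

(* The set T of types is the type variable 't; its arrow operation is an explicit parameter arr,
   which need not be injective.  Hence the application symbols carry both sort indices. *)

datatype 't cl_term =
    Var 't nat
  | App 't 't "'t cl_term" "'t cl_term"
  | CI 't
  | CK 't 't
  | CS 't 't 't

inductive has_sort :: "('t \<Rightarrow> 't \<Rightarrow> 't) \<Rightarrow> 't cl_term \<Rightarrow> 't \<Rightarrow> bool"
  for arr :: "'t \<Rightarrow> 't \<Rightarrow> 't" where
  "has_sort arr (Var i n) i"
| "has_sort arr t (arr i j) \<Longrightarrow> has_sort arr u i \<Longrightarrow> has_sort arr (App i j t u) j"
| "has_sort arr (CI i) (arr i i)"
| "has_sort arr (CK i j) (arr i (arr j i))"
| "has_sort arr (CS i j k) (arr (arr i (arr j k)) (arr (arr i j) (arr i k)))"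

primrec subst_term :: "('t \<Rightarrow> nat \<Rightarrow> 't cl_term) \<Rightarrow> 't cl_term \<Rightarrow> 't cl_term" where
  "subst_term f (Var i n) = f i n"
| "subst_term f (App i j t u) = App i j (subst_term f t) (subst_term f u)"
| "subst_term f (CI i) = CI i"
| "subst_term f (CK i j) = CK i j"
| "subst_term f (CS i j k) = CS i j k"

definition substitution :: "('t \<Rightarrow> 't \<Rightarrow> 't) \<Rightarrow> ('t \<Rightarrow> nat \<Rightarrow> 't cl_term) \<Rightarrow> bool" where
  "substitution arr f \<longleftrightarrow> (\<forall>i n. has_sort arr (f i n) i)"

datatype 't qeq =
  QEq "'t cl_term" 't rat "'t cl_term"  ("_ \<simeq>\<^bsub>_,_\<^esub> _" [61, 0, 0, 61] 60)

(* The raw types above also contain ill-sorted terms and negative rationals;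
   quant_eqs selects the genuine quantitative equations. *)

definition quant_eqs :: "('t \<Rightarrow> 't \<Rightarrow> 't) \<Rightarrow> 't qeq set" where
  "quant_eqs arr = {t \<simeq>\<^bsub>i,\<epsilon>\<^esub> s | t i \<epsilon> s. has_sort arr t i \<and> has_sort arr s i \<and> \<epsilon> \<ge> 0}"

primrec subst_qeq :: "('t \<Rightarrow> nat \<Rightarrow> 't cl_term) \<Rightarrow> 't qeq \<Rightarrow> 't qeq" where
  "subst_qeq f (t \<simeq>\<^bsub>i,\<epsilon>\<^esub> s) = (subst_term f t \<simeq>\<^bsub>i,\<epsilon>\<^esub> subst_term f s)"

type_synonym 't inference = "'t qeq set \<times> 't qeq"

(* The least consequence relation on well-sorted equations that contains S. *)

inductive derives ::
  "('t \<Rightarrow> 't \<Rightarrow> 't) \<Rightarrow> 't inference set \<Rightarrow> 't qeq set \<Rightarrow> 't qeq \<Rightarrow> bool"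
  for arr :: "'t \<Rightarrow> 't \<Rightarrow> 't" and S :: "'t inference set" where
  Base: "(\<Gamma>, \<phi>) \<in> S \<Longrightarrow> derives arr S \<Gamma> \<phi>"
| Cut: "\<Gamma> \<subseteq> quant_eqs arr \<Longrightarrow> (\<And>\<phi>. \<phi> \<in> \<Gamma>' \<Longrightarrow> derives arr S \<Gamma> \<phi>) \<Longrightarrow> derives arr S \<Gamma>' \<psi>
    \<Longrightarrow> derives arr S \<Gamma> \<psi>"
| Assumpt: "\<Gamma> \<subseteq> quant_eqs arr \<Longrightarrow> \<phi> \<in> \<Gamma> \<Longrightarrow> derives arr S \<Gamma> \<phi>"
| Refl: "has_sort arr t i \<Longrightarrow> derives arr S {} (t \<simeq>\<^bsub>i,0\<^esub> t)"
| Symm: "has_sort arr t i \<Longrightarrow> has_sort arr s i \<Longrightarrow> \<epsilon> \<ge> 0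
    \<Longrightarrow> derives arr S {t \<simeq>\<^bsub>i,\<epsilon>\<^esub> s} (s \<simeq>\<^bsub>i,\<epsilon>\<^esub> t)"
| Triang: "has_sort arr t i \<Longrightarrow> has_sort arr s i \<Longrightarrow> has_sort arr u i \<Longrightarrow> \<epsilon> \<ge> 0 \<Longrightarrow> \<delta> \<ge> 0
    \<Longrightarrow> derives arr S {t \<simeq>\<^bsub>i,\<epsilon>\<^esub> s, s \<simeq>\<^bsub>i,\<delta>\<^esub> u} (t \<simeq>\<^bsub>i,\<epsilon> + \<delta>\<^esub> u)"
| Max: "has_sort arr t i \<Longrightarrow> has_sort arr s i \<Longrightarrow> \<epsilon> \<ge> 0 \<Longrightarrow> \<delta> \<ge> 0
    \<Longrightarrow> derives arr S {t \<simeq>\<^bsub>i,\<epsilon>\<^esub> s} (t \<simeq>\<^bsub>i,\<epsilon> + \<delta>\<^esub> s)"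
| Arch: "has_sort arr t i \<Longrightarrow> has_sort arr s i \<Longrightarrow> \<epsilon> \<ge> 0
    \<Longrightarrow> derives arr S {t \<simeq>\<^bsub>i,\<delta>\<^esub> s | \<delta>. \<delta> > \<epsilon>} (t \<simeq>\<^bsub>i,\<epsilon>\<^esub> s)"
| NExp_App: "has_sort arr t (arr i j) \<Longrightarrow> has_sort arr t' (arr i j)
    \<Longrightarrow> has_sort arr u i \<Longrightarrow> has_sort arr u' i \<Longrightarrow> \<epsilon> \<ge> 0
    \<Longrightarrow> derives arr S {t \<simeq>\<^bsub>arr i j,\<epsilon>\<^esub> t', u \<simeq>\<^bsub>i,\<epsilon>\<^esub> u'} (App i j t u \<simeq>\<^bsub>j,\<epsilon>\<^esub> App i j t' u')"
| NExp_I: "has_sort arr (CI i) k \<Longrightarrow> \<epsilon> \<ge> 0 \<Longrightarrow> derives arr S {} (CI i \<simeq>\<^bsub>k,\<epsilon>\<^esub> CI i)"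
| NExp_K: "has_sort arr (CK i j) k \<Longrightarrow> \<epsilon> \<ge> 0 \<Longrightarrow> derives arr S {} (CK i j \<simeq>\<^bsub>k,\<epsilon>\<^esub> CK i j)"
| NExp_S: "has_sort arr (CS i j k) l \<Longrightarrow> \<epsilon> \<ge> 0
    \<Longrightarrow> derives arr S {} (CS i j k \<simeq>\<^bsub>l,\<epsilon>\<^esub> CS i j k)"
| Subst: "substitution arr f \<Longrightarrow> derives arr S \<Gamma> \<phi>
    \<Longrightarrow> derives arr S (subst_qeq f ` \<Gamma>) (subst_qeq f \<phi>)"

definition basic_inferences :: "('t \<Rightarrow> 't \<Rightarrow> 't) \<Rightarrow> 't inference set" where
  "basic_inferences arr = {(\<Gamma>, \<phi>). finite \<Gamma> \<and> \<phi> \<in> quant_eqs arr \<and>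
     \<Gamma> \<subseteq> {Var i m \<simeq>\<^bsub>i,\<epsilon>\<^esub> Var i n | i m n \<epsilon>. \<epsilon> \<ge> 0}}"

definition generated_theory :: "('t \<Rightarrow> 't \<Rightarrow> 't) \<Rightarrow> 't inference set \<Rightarrow> 't inference set" where
  "generated_theory arr S = {(\<Gamma>, \<phi>). finite \<Gamma> \<and> derives arr S \<Gamma> \<phi>}"

definition CL_axioms :: "('t \<Rightarrow> 't \<Rightarrow> 't) \<Rightarrow> 't inference set" where
  "CL_axioms arr =
     {({}, App i i (CI i) t \<simeq>\<^bsub>i,0\<^esub> t) | i t. has_sort arr t i}
   \<union> {({}, App j i (App i (arr j i) (CK i j) t) u \<simeq>\<^bsub>i,0\<^esub> t) | i j t u.
        has_sort arr t i \<and> has_sort arr u j}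
   \<union> {({}, App i k
             (App (arr i j) (arr i k)
               (App (arr i (arr j k)) (arr (arr i j) (arr i k)) (CS i j k) t) u) w
           \<simeq>\<^bsub>k,0\<^esub> App j k (App i (arr j k) t w) (App i j u w)) | i j k t u w.
        has_sort arr t (arr i (arr j k)) \<and> has_sort arr u (arr i j) \<and> has_sort arr w i}"

definition quantitative_weak_lambda_theory ::
  "('t \<Rightarrow> 't \<Rightarrow> 't) \<Rightarrow> 't inference set \<Rightarrow> bool" where
  "quantitative_weak_lambda_theory arr U \<longleftrightarrow>
     (\<exists>S \<subseteq> basic_inferences arr. U = generated_theory arr S) \<and>
     generated_theory arr (CL_axioms arr) \<subseteq> U"

(* The carriers car A i of different sorts may overlap and may be empty. *)

record ('t, 'a) qalg =
  car :: "'t \<Rightarrow> 'a set"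
  pdist :: "'t \<Rightarrow> 'a \<Rightarrow> 'a \<Rightarrow> ennreal"
  app :: "'t \<Rightarrow> 't \<Rightarrow> 'a \<Rightarrow> 'a \<Rightarrow> 'a"
  ci :: "'t \<Rightarrow> 'a"
  ck :: "'t \<Rightarrow> 't \<Rightarrow> 'a"
  cs :: "'t \<Rightarrow> 't \<Rightarrow> 't \<Rightarrow> 'a"

locale quantitative_algebra =
  fixes arr :: "'t \<Rightarrow> 't \<Rightarrow> 't" and A :: "('t, 'a) qalg"
  assumes pdist_self: "x \<in> car A i \<Longrightarrow> pdist A i x x = 0"
    and pdist_sym: "x \<in> car A i \<Longrightarrow> y \<in> car A i \<Longrightarrow> pdist A i x y = pdist A i y x"
    and pdist_triangle: "x \<in> car A i \<Longrightarrow> y \<in> car A i \<Longrightarrow> z \<in> car A i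
      \<Longrightarrow> pdist A i x z \<le> pdist A i x y + pdist A i y z"
    and app_closed: "x \<in> car A (arr i j) \<Longrightarrow> y \<in> car A i \<Longrightarrow> app A i j x y \<in> car A j"
    and app_nonexpansive: "x \<in> car A (arr i j) \<Longrightarrow> x' \<in> car A (arr i j)
      \<Longrightarrow> y \<in> car A i \<Longrightarrow> y' \<in> car A i
      \<Longrightarrow> pdist A j (app A i j x y) (app A i j x' y')
            \<le> max (pdist A (arr i j) x x') (pdist A i y y')"
    and ci_closed: "ci A i \<in> car A (arr i i)"
    and ck_closed: "ck A i j \<in> car A (arr i (arr j i))"
    and cs_closed: "cs A i j k \<in> car A (arr (arr i (arr j k)) (arr (arr i j) (arr i k)))"

primrec eval_term :: "('t, 'a) qalg \<Rightarrow> ('t \<Rightarrow> nat \<Rightarrow> 'a) \<Rightarrow> 't cl_term \<Rightarrow> 'a" where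
  "eval_term A f (Var i n) = f i n"
| "eval_term A f (App i j t u) = app A i j (eval_term A f t) (eval_term A f u)"
| "eval_term A f (CI i) = ci A i"
| "eval_term A f (CK i j) = ck A i j"
| "eval_term A f (CS i j k) = cs A i j k"

primrec holds :: "('t, 'a) qalg \<Rightarrow> ('t \<Rightarrow> nat \<Rightarrow> 'a) \<Rightarrow> 't qeq \<Rightarrow> bool" where
  "holds A f (t \<simeq>\<^bsub>i,\<epsilon>\<^esub> s) \<longleftrightarrow>
     pdist A i (eval_term A f t) (eval_term A f s) \<le> ennreal (of_rat \<epsilon>)"

definition entails :: "('t, 'a) qalg \<Rightarrow> 't qeq set \<Rightarrow> 't qeq \<Rightarrow> bool" where
  "entails A \<Gamma> \<phi> \<longleftrightarrow>
     (\<forall>f. (\<forall>i n. f i n \<in> car A i) \<longrightarrow> (\<forall>\<psi>\<in>\<Gamma>. holds A f \<psi>) \<longrightarrow> holds A f \<phi>)"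

definition satisfies :: "('t, 'a) qalg \<Rightarrow> 't inference set \<Rightarrow> bool" where
  "satisfies A U \<longleftrightarrow> (\<forall>(\<Gamma>, \<phi>)\<in>U. entails A \<Gamma> \<phi>)"

(* HOL cannot quantify over types inside a formula.  "Every algebra" is therefore rendered as
   every algebra with carriers in an arbitrary type 'a, or in the type of terms.  The former gives
   soundness for algebras of any size (the theorem is polymorphic in 'a); the latter makes
   completeness hold even when 'a is small.  With 'a the type of terms, the two coincide. *)

definition valid_in_algebras_over ::
  "'a itself \<Rightarrow> ('t \<Rightarrow> 't \<Rightarrow> 't) \<Rightarrow> 't inference set \<Rightarrow> 't qeq set \<Rightarrow> 't qeq \<Rightarrow> bool" where
  "valid_in_algebras_over _ arr U \<Gamma> \<phi> \<longleftrightarrow>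
     (\<forall>A :: ('t, 'a) qalg. quantitative_algebra arr A \<longrightarrow> satisfies A U \<longrightarrow> entails A \<Gamma> \<phi>)"

end

theory Submission
  imports Defs
begin

text \<open>
  Soundness is immediate from the definition of satisfaction.  For completeness, fix \<open>\<Gamma>\<close> and equip
  the terms with the pseudo-metric whose value at \<open>t, s\<close> is the infimum of all \<open>\<epsilon>\<close> such that
  \<open>\<Gamma>\<close> proves \<open>t\<close> and \<open>s\<close> to be at distance \<open>\<epsilon>\<close>.  By (Max) and (Arch) the distance is at most
  \<open>\<epsilon>\<close> exactly when this is provable.  Valuations into the term algebra are substitutions, so the
  algebra satisfies the theory by (Subst) and (Cut), and the identity valuation satisfies \<open>\<Gamma>\<close>;
  hence an equation entailed by \<open>\<Gamma>\<close> in this algebra is provable from \<open>\<Gamma>\<close>.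
\<close>

section \<open>Well-sortedness of terms, equations and derivations\<close>

lemma has_sort_subst_term:
  assumes "substitution arr f" and "has_sort arr t i"
  shows "has_sort arr (subst_term f t) i"
  using assms(2,1)
  by (induction rule: has_sort.induct) (auto simp: substitution_def intro: has_sort.intros)

lemma quant_eqs_iff [simp]:
  "(t \<simeq>\<^bsub>i,\<epsilon>\<^esub> s) \<in> quant_eqs arr \<longleftrightarrow> has_sort arr t i \<and> has_sort arr s i \<and> \<epsilon> \<ge> 0"
  by (auto simp: quant_eqs_def)

lemma subst_qeq_quant_eqs:
  assumes "substitution arr f" and "\<phi> \<in> quant_eqs arr"
  shows "subst_qeq f \<phi> \<in> quant_eqs arr"
  using assms by (cases \<phi>) (auto intro: has_sort_subst_term)

lemma basic_inferences_quant_eqs: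
  assumes "(\<Gamma>, \<phi>) \<in> basic_inferences arr"
  shows "\<Gamma> \<subseteq> quant_eqs arr" and "\<phi> \<in> quant_eqs arr"
proof -
  have "{Var i m \<simeq>\<^bsub>i,\<epsilon>\<^esub> Var i n | i m n \<epsilon>. \<epsilon> \<ge> 0} \<subseteq> quant_eqs arr"
    by (auto intro: has_sort.intros)
  then show "\<Gamma> \<subseteq> quant_eqs arr"
    using assms by (auto simp: basic_inferences_def)
  show "\<phi> \<in> quant_eqs arr"
    using assms by (simp add: basic_inferences_def)
qed

text \<open>The rules carry sort and sign conditions for their equations, \<open>Base\<close>
  inherits them from the basic inferences, and \<open>Subst\<close> preserves them. Sorts and
  non-negativity can therefore be read off any derivation.\<close>

lemma derives_quant_eqs:
  assumes "derives arr S \<Gamma> \<phi>" and "S \<subseteq> basic_inferences arr"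
  shows "\<Gamma> \<subseteq> quant_eqs arr \<and> \<phi> \<in> quant_eqs arr"
  using assms
proof (induction rule: derives.induct)
  case (Base \<Gamma> \<phi>)
  then show ?case using basic_inferences_quant_eqs by blast
next
  case (Subst f \<Gamma> \<phi>)
  then show ?case by (auto intro: subst_qeq_quant_eqs)
qed (auto simp: has_sort.intros)

section \<open>The term algebra and its distance\<close>

definition provable_dist ::
  "('t \<Rightarrow> 't \<Rightarrow> 't) \<Rightarrow> 't inference set \<Rightarrow> 't qeq set \<Rightarrow> 't \<Rightarrow> 't cl_term \<Rightarrow> 't cl_term \<Rightarrow> ennreal"
  where "provable_dist arr S \<Gamma> i t s =
    (INF \<epsilon>\<in>{\<epsilon>. derives arr S \<Gamma> (t \<simeq>\<^bsub>i,\<epsilon>\<^esub> s)}. ennreal (of_rat \<epsilon>))"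

text \<open>The carriers cut out the ill-sorted raw terms. Two terms for which no bound is derivable
  are at distance \<open>top\<close>, the infimum of the empty set.\<close>

definition term_algebra ::
  "('t \<Rightarrow> 't \<Rightarrow> 't) \<Rightarrow> 't inference set \<Rightarrow> 't qeq set \<Rightarrow> ('t, 't cl_term) qalg"
  where "term_algebra arr S \<Gamma> =
    \<lparr>car = (\<lambda>i. {t. has_sort arr t i}), pdist = provable_dist arr S \<Gamma>,
     app = App, ci = CI, ck = CK, cs = CS\<rparr>"

lemma term_algebra_simps [simp]:
  "car (term_algebra arr S \<Gamma>) i = {t. has_sort arr t i}"
  "pdist (term_algebra arr S \<Gamma>) = provable_dist arr S \<Gamma>"
  "app (term_algebra arr S \<Gamma>) = App"
  "ci (term_algebra arr S \<Gamma>) = CI"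
  "ck (term_algebra arr S \<Gamma>) = CK"
  "cs (term_algebra arr S \<Gamma>) = CS"
  by (simp_all add: term_algebra_def)

lemma eval_term_algebra [simp]: "eval_term (term_algebra arr S \<Gamma>) f t = subst_term f t"
  by (induction t) simp_all

lemma subst_term_Var [simp]: "subst_term Var t = t"
  by (induction t) simp_all

lemma subst_qeq_Var [simp]: "subst_qeq Var \<phi> = \<phi>"
  by (cases \<phi>) simp

lemma provable_dist_leI:
  assumes "derives arr S \<Gamma> (t \<simeq>\<^bsub>i,\<epsilon>\<^esub> s)"
  shows "provable_dist arr S \<Gamma> i t s \<le> ennreal (of_rat \<epsilon>)"
  unfolding provable_dist_def using assms by (intro INF_lower) simp

lemma provable_dist_lessE:
  assumes "provable_dist arr S \<Gamma> i t s < d"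
  obtains \<epsilon> where "derives arr S \<Gamma> (t \<simeq>\<^bsub>i,\<epsilon>\<^esub> s)" and "ennreal (of_rat \<epsilon>) < d"
  using assms unfolding provable_dist_def INF_less_iff by auto

section \<open>Derivability from a fixed set \<open>\<Gamma>\<close>, and the term algebra as a
  model\<close>

context
  fixes arr :: "'t \<Rightarrow> 't \<Rightarrow> 't" and S :: "'t inference set" and \<Gamma> :: "'t qeq set"
  assumes S: "S \<subseteq> basic_inferences arr" and \<Gamma>: "\<Gamma> \<subseteq> quant_eqs arr"
begin

lemma derives_sorts:
  assumes "derives arr S \<Gamma> (t \<simeq>\<^bsub>i,\<epsilon>\<^esub> s)"
  shows "has_sort arr t i" and "has_sort arr s i" and "\<epsilon> \<ge> 0"
  using derives_quant_eqs[OF assms S] by simp_all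

lemma derives_refl:
  assumes "has_sort arr t i"
  shows "derives arr S \<Gamma> (t \<simeq>\<^bsub>i,0\<^esub> t)"
  \<comment> \<open>The rules of the calculus have exactly their premises as left-hand side;
    \<open>Cut\<close> transports them to \<open>\<Gamma>\<close>. The placeholder \<open>_\<close>
    leaves open the premise of \<open>Cut\<close> that these hypotheses follow from
    \<open>\<Gamma>\<close>. The lemmas below use the same pattern.\<close>
  using \<Gamma> _ derives.Refl[OF assms] by (rule derives.Cut) simp

lemma derives_sym:
  assumes "derives arr S \<Gamma> (t \<simeq>\<^bsub>i,\<epsilon>\<^esub> s)"
  shows "derives arr S \<Gamma> (s \<simeq>\<^bsub>i,\<epsilon>\<^esub> t)"
  using \<Gamma> _ derives.Symm[OF derives_sorts[OF assms]]
  by (rule derives.Cut) (use assms in auto)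

lemma derives_trans:
  assumes "derives arr S \<Gamma> (t \<simeq>\<^bsub>i,\<epsilon>\<^esub> s)" and "derives arr S \<Gamma> (s \<simeq>\<^bsub>i,\<delta>\<^esub> u)"
  shows "derives arr S \<Gamma> (t \<simeq>\<^bsub>i,\<epsilon> + \<delta>\<^esub> u)"
  using \<Gamma> _ derives.Triang[OF derives_sorts(1,2)[OF assms(1)] derives_sorts(2)[OF assms(2)]
    derives_sorts(3)[OF assms(1)] derives_sorts(3)[OF assms(2)]]
  by (rule derives.Cut) (use assms in auto)

lemma derives_mono:
  assumes "derives arr S \<Gamma> (t \<simeq>\<^bsub>i,\<epsilon>\<^esub> s)" and "\<epsilon> \<le> \<delta>"
  shows "derives arr S \<Gamma> (t \<simeq>\<^bsub>i,\<delta>\<^esub> s)"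
proof -
  have "derives arr S {t \<simeq>\<^bsub>i,\<epsilon>\<^esub> s} (t \<simeq>\<^bsub>i,\<epsilon> + (\<delta> - \<epsilon>)\<^esub> s)"
    using derives_sorts[OF assms(1)] assms(2) by (intro derives.Max) auto
  with \<Gamma> _ have "derives arr S \<Gamma> (t \<simeq>\<^bsub>i,\<epsilon> + (\<delta> - \<epsilon>)\<^esub> s)"
    by (rule derives.Cut) (use assms(1) in auto)
  then show ?thesis by simp
qed

lemma derives_arch:
  assumes "has_sort arr t i" and "has_sort arr s i" and "\<epsilon> \<ge> 0"
    and "\<And>\<delta>. \<delta> > \<epsilon> \<Longrightarrow> derives arr S \<Gamma> (t \<simeq>\<^bsub>i,\<delta>\<^esub> s)"
  shows "derives arr S \<Gamma> (t \<simeq>\<^bsub>i,\<epsilon>\<^esub> s)"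
  using \<Gamma> _ derives.Arch[OF assms(1-3)] by (rule derives.Cut) (use assms(4) in auto)

lemma derives_App:
  assumes "derives arr S \<Gamma> (t \<simeq>\<^bsub>arr i j,\<epsilon>\<^esub> t')" and "derives arr S \<Gamma> (u \<simeq>\<^bsub>i,\<epsilon>\<^esub> u')"
  shows "derives arr S \<Gamma> (App i j t u \<simeq>\<^bsub>j,\<epsilon>\<^esub> App i j t' u')"
  using \<Gamma> _ derives.NExp_App[OF derives_sorts(1,2)[OF assms(1)] derives_sorts[OF assms(2)]]
  by (rule derives.Cut) (use assms in auto)

text \<open>The infimum is attained at rational bounds: for each \<delta> > \<epsilon> some
  derivable \<epsilon>' lies below \<delta>, (Max) raises it to \<delta>, and (Arch) passes to the
  limit \<epsilon>.\<close>

lemma provable_dist_le_iff: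
  assumes "has_sort arr t i" and "has_sort arr s i" and "\<epsilon> \<ge> 0"
  shows "provable_dist arr S \<Gamma> i t s \<le> ennreal (of_rat \<epsilon>) \<longleftrightarrow> derives arr S \<Gamma> (t \<simeq>\<^bsub>i,\<epsilon>\<^esub> s)"
proof
  assume le: "provable_dist arr S \<Gamma> i t s \<le> ennreal (of_rat \<epsilon>)"
  show "derives arr S \<Gamma> (t \<simeq>\<^bsub>i,\<epsilon>\<^esub> s)"
    using assms
  proof (rule derives_arch)
    fix \<delta> assume "\<delta> > \<epsilon>"
    then have "ennreal (of_rat \<epsilon>) < ennreal (of_rat \<delta>)"
      using assms(3) by (simp add: ennreal_less_iff of_rat_less)
    with le have "provable_dist arr S \<Gamma> i t s < ennreal (of_rat \<delta>)"
      by (rule le_less_trans)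
    then obtain \<epsilon>' where \<epsilon>': "derives arr S \<Gamma> (t \<simeq>\<^bsub>i,\<epsilon>'\<^esub> s)"
      and less: "ennreal (of_rat \<epsilon>') < ennreal (of_rat \<delta>)"
      by (rule provable_dist_lessE)
    \<comment> \<open>\<open>ennreal\<close> sends negative reals to 0, so the comparison is carried
      back to the rationals using \<epsilon>' \<ge> 0, which the derivation supplies.\<close>
    have "\<epsilon>' \<le> \<delta>"
      using less derives_sorts(3)[OF \<epsilon>'] by (simp add: ennreal_less_iff of_rat_less)
    with \<epsilon>' show "derives arr S \<Gamma> (t \<simeq>\<^bsub>i,\<delta>\<^esub> s)"
      by (rule derives_mono)
  qed
qed (rule provable_dist_leI)

text \<open>(Symm) embeds one index set of the infima into the other. Used in both directions, this
  yields equality by antisymmetry.\<close>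

lemma provable_dist_sym_le: "provable_dist arr S \<Gamma> i t s \<le> provable_dist arr S \<Gamma> i s t"
  unfolding provable_dist_def using derives_sym by (intro INF_superset_mono) auto

lemma provable_dist_triangle:
  "provable_dist arr S \<Gamma> i t u \<le> provable_dist arr S \<Gamma> i t s + provable_dist arr S \<Gamma> i s u"
proof (rule ennreal_le_epsilon)
  fix e :: real
  assume fin: "provable_dist arr S \<Gamma> i t s + provable_dist arr S \<Gamma> i s u < top" and e: "0 < e"
  \<comment> \<open>Both distances are finite because their sum is, so adding \<open>e / 2\<close>
    increases each strictly. The gap leaves room for derivable bounds \<epsilon> and \<delta>, to
    which (Triang) applies.\<close>
  have "provable_dist arr S \<Gamma> i t s < provable_dist arr S \<Gamma> i t s + ennreal (e / 2)"
    "provable_dist arr S \<Gamma> i s u < provable_dist arr S \<Gamma> i s u + ennreal (e / 2)"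
    using fin e ennreal_add_left_cancel_less[of _ 0 "ennreal (e / 2)"] by auto
  then obtain \<epsilon> \<delta> where d: "derives arr S \<Gamma> (t \<simeq>\<^bsub>i,\<epsilon>\<^esub> s)" "derives arr S \<Gamma> (s \<simeq>\<^bsub>i,\<delta>\<^esub> u)"
    and less: "ennreal (of_rat \<epsilon>) < provable_dist arr S \<Gamma> i t s + ennreal (e / 2)"
      "ennreal (of_rat \<delta>) < provable_dist arr S \<Gamma> i s u + ennreal (e / 2)"
    by (elim provable_dist_lessE)
  have "provable_dist arr S \<Gamma> i t u \<le> ennreal (of_rat (\<epsilon> + \<delta>))"
    using d by (intro provable_dist_leI derives_trans)
  also have "\<dots> = ennreal (of_rat \<epsilon>) + ennreal (of_rat \<delta>)"
    using d[THEN derives_sorts(3)] by (simp add: of_rat_add ennreal_plus)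
  also have "\<dots> \<le> (provable_dist arr S \<Gamma> i t s + ennreal (e / 2))
      + (provable_dist arr S \<Gamma> i s u + ennreal (e / 2))"
    using less by (intro add_mono less_imp_le)
  also have "\<dots> = provable_dist arr S \<Gamma> i t s + provable_dist arr S \<Gamma> i s u
      + (ennreal (e / 2) + ennreal (e / 2))"
    by (simp add: ac_simps)
  also have "ennreal (e / 2) + ennreal (e / 2) = ennreal e"
    using e by (simp flip: ennreal_plus)
  finally show "provable_dist arr S \<Gamma> i t u
      \<le> provable_dist arr S \<Gamma> i t s + provable_dist arr S \<Gamma> i s u + ennreal e" .
qed

text \<open>Were the maximum strictly smaller, both argument distances would have derivable bounds
  below the distance of the applications. (NExp) wants one common bound, so (Max) first raises both
  to the larger; the result contradicts the infimum.\<close>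

lemma provable_dist_App:
  "provable_dist arr S \<Gamma> j (App i j t u) (App i j t' u')
     \<le> max (provable_dist arr S \<Gamma> (arr i j) t t') (provable_dist arr S \<Gamma> i u u')"
proof (rule ccontr)
  assume "\<not> ?thesis"
  then obtain \<epsilon> \<delta> where
    d: "derives arr S \<Gamma> (t \<simeq>\<^bsub>arr i j,\<epsilon>\<^esub> t')" "derives arr S \<Gamma> (u \<simeq>\<^bsub>i,\<delta>\<^esub> u')"
    and less: "ennreal (of_rat \<epsilon>) < provable_dist arr S \<Gamma> j (App i j t u) (App i j t' u')"
      "ennreal (of_rat \<delta>) < provable_dist arr S \<Gamma> j (App i j t u) (App i j t' u')"
    unfolding not_le max_less_iff_conj by (elim conjE provable_dist_lessE)
  have "derives arr S \<Gamma> (App i j t u \<simeq>\<^bsub>j,max \<epsilon> \<delta>\<^esub> App i j t' u')"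
    by (intro derives_App derives_mono[OF d(1)] derives_mono[OF d(2)] max.cobounded1 max.cobounded2)
  from provable_dist_leI[OF this] less show False
    by (auto simp: max_def split: if_splits)
qed

lemma quantitative_algebra_term_algebra: "quantitative_algebra arr (term_algebra arr S \<Gamma>)"
proof (unfold_locales, goal_cases)
  case (1 t i)
  then show ?case
    using provable_dist_leI[OF derives_refl, of t i] by simp
next
  case (2 t i s)
  show ?case
    by (simp add: antisym provable_dist_sym_le)
next
  case (3 t i s u)
  show ?case
    by (simp add: provable_dist_triangle)
next
  case (5 t i j t' u u')
  show ?case
    by (simp add: provable_dist_App)
\<comment> \<open>The remaining cases are the closure conditions, which are the sorting rules
  themselves.\<close>
qed (simp_all add: has_sort.intros)

text \<open>The bridge between semantics and syntax: evaluation under \<open>f\<close> is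
  substitution by \<open>f\<close>, and a rational bound on the distance is a derivable
  equation.\<close>

lemma holds_term_algebra_iff:
  assumes "substitution arr f" and "\<phi> \<in> quant_eqs arr"
  shows "holds (term_algebra arr S \<Gamma>) f \<phi> \<longleftrightarrow> derives arr S \<Gamma> (subst_qeq f \<phi>)"
  using assms by (cases \<phi>) (simp add: provable_dist_le_iff has_sort_subst_term)

lemma satisfies_term_algebra: "satisfies (term_algebra arr S \<Gamma>) (generated_theory arr S)"
proof -
  have "holds (term_algebra arr S \<Gamma>) f \<phi>"
    if d: "derives arr S \<Delta> \<phi>" and "\<forall>i n. f i n \<in> car (term_algebra arr S \<Gamma>) i"
      and holds: "\<forall>\<psi>\<in>\<Delta>. holds (term_algebra arr S \<Gamma>) f \<psi>"
    for \<Delta> \<phi> f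
  proof -
    have f: "substitution arr f"
      using that(2) by (simp add: substitution_def)
    have wf: "\<Delta> \<subseteq> quant_eqs arr" "\<phi> \<in> quant_eqs arr"
      using derives_quant_eqs[OF d S] by auto
    have "derives arr S \<Gamma> \<chi>" if "\<chi> \<in> subst_qeq f ` \<Delta>" for \<chi>
      using that holds wf(1) by (auto simp flip: holds_term_algebra_iff[OF f])
    \<comment> \<open>(Subst) instantiates the whole inference by \<open>f\<close>; (Cut) then
      discharges the instantiated hypotheses, all derivable from \<open>\<Gamma>\<close>.\<close>
    then have "derives arr S \<Gamma> (subst_qeq f \<phi>)"
      using derives.Subst[OF f d] by (rule derives.Cut[OF \<Gamma>])
    then show ?thesis
      using f wf(2) by (simp add: holds_term_algebra_iff)
  qed
  then show ?thesis
    by (auto simp: satisfies_def generated_theory_def entails_def)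
qed

lemma derives_if_entails_term_algebra:
  assumes "entails (term_algebra arr S \<Gamma>) \<Gamma> \<phi>" and "\<phi> \<in> quant_eqs arr"
  shows "derives arr S \<Gamma> \<phi>"
proof -
  have Var: "substitution arr Var"
    by (simp add: substitution_def has_sort.intros)
  have "holds (term_algebra arr S \<Gamma>) Var \<psi>" if "\<psi> \<in> \<Gamma>" for \<psi>
    \<comment> \<open>Substituting \<open>Var\<close> changes nothing, so the claim reduces to
      (Assumpt).\<close>
    using that \<Gamma> by (subst holds_term_algebra_iff[OF Var]) (auto intro: derives.Assumpt)
  with assms(1) have "holds (term_algebra arr S \<Gamma>) Var \<phi>"
    using Var by (simp add: entails_def substitution_def)
  then show ?thesis
    using assms(2) by (simp add: holds_term_algebra_iff[OF Var])
qed

end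

theorem mainTheorem3:
  fixes arr :: "'t \<Rightarrow> 't \<Rightarrow> 't"
    and U :: "'t inference set"
    and \<Gamma> :: "'t qeq set"
    and \<phi> :: "'t qeq"
  assumes "quantitative_weak_lambda_theory arr U"
    and "finite \<Gamma>" and "\<Gamma> \<subseteq> quant_eqs arr" and "\<phi> \<in> quant_eqs arr"
  shows "(\<Gamma>, \<phi>) \<in> U \<longleftrightarrow>
    valid_in_algebras_over TYPE('a) arr U \<Gamma> \<phi> \<and>
    valid_in_algebras_over TYPE('t cl_term) arr U \<Gamma> \<phi>"
proof
  assume "(\<Gamma>, \<phi>) \<in> U"
  then show "valid_in_algebras_over TYPE('a) arr U \<Gamma> \<phi> \<and>
      valid_in_algebras_over TYPE('t cl_term) arr U \<Gamma> \<phi>"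
    by (auto simp: valid_in_algebras_over_def satisfies_def)
next
  assume valid: "valid_in_algebras_over TYPE('a) arr U \<Gamma> \<phi> \<and>
      valid_in_algebras_over TYPE('t cl_term) arr U \<Gamma> \<phi>"
  obtain S where S: "S \<subseteq> basic_inferences arr" and U: "U = generated_theory arr S"
    using assms(1) by (auto simp: quantitative_weak_lambda_theory_def)
  \<comment> \<open>The elements of the term algebra have type \<open>'t cl_term\<close>, so the
    second conjunct of \<open>valid\<close> applies to it.\<close>
  have "entails (term_algebra arr S \<Gamma>) \<Gamma> \<phi>"
    using valid quantitative_algebra_term_algebra[OF S assms(3)]
      satisfies_term_algebra[OF S assms(3)]
    by (simp add: valid_in_algebras_over_def U)
  then have "derives arr S \<Gamma> \<phi>"
    using assms(4) by (rule derives_if_entails_term_algebra[OF S assms(3)])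
  with assms(2) show "(\<Gamma>, \<phi>) \<in> U"
    by (simp add: U generated_theory_def)
qed

end
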